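(* Let $\sum_{n=1}^\infty a_n$ be a positive series, i.e. $(a_n)_{n\ge 1}$ is a sequence of real numbers with $a_n>0$ for all $n\geq 1$. Then $\sum_{n=1}^\infty a_n$ is convergent if and only if there exist a sequence $\{B_n\}_{n=1}^\infty$ of positive real numbers and an integer $N\geq 1$ such that $$B_n\cdot \frac{a_n}{a_{n+1}}-B_{n+1}\geq 1\quad\text{for all } n\geq N.$$
   Context: A positive series is a series of real numbers all of whose terms are strictly positive. Convergence means that the sequence of partial sums $\sum_{k=1}^n a_k$ converges to a finite real limit as $n\to\infty$ (equivalently, for a positive series, that the partial sums have a finite upper bound). *)

theory Defs
  imports Complex_Main
begin

end

(* Kummer's test. For the forward direction take B n = (remainder after n) / a n, which gives
   equality. Conversely, the condition says that S n + B n * a n is nonincreasing from N on, where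
   S denotes the partial sums, so S is bounded above. *)
theory Submission
  imports Defs
begin

theorem theorem1:
  fixes a :: "nat \<Rightarrow> real"
  assumes "\<And>n. n \<ge> 1 \<Longrightarrow> a n > 0"
  shows "convergent (\<lambda>n. \<Sum>k=1..n. a k) \<longleftrightarrow>
    (\<exists>(B :: nat \<Rightarrow> real) (N :: nat). (\<forall>n\<ge>1. B n > 0) \<and> N \<ge> 1 \<and>
      (\<forall>n\<ge>N. B n * (a n / a (n + 1)) - B (n + 1) \<ge> 1))"
    (is "convergent ?S \<longleftrightarrow> ?R")
proof
  have S_Suc: "?S (Suc n) = ?S n + a (Suc n)" for n
    by simp
  have S_less: "?S n < ?S (Suc n)" for n
    unfolding S_Suc using assms[of "Suc n"] by simp
  then have inc: "incseq ?S"
    by (intro incseq_SucI less_imp_le)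
  {
    assume "convergent ?S"
    then obtain L where "?S \<longlonglongrightarrow> L"
      by (auto simp: convergent_def)
    with inc have "?S n \<le> L" for n
      by (rule incseq_le)
    \<comment> \<open>Strictness is what makes \<open>B n\<close> positive: the next partial sum is
      already larger and still at most \<open>L\<close>.\<close>
    then have S_less_L: "?S n < L" for n
      using S_less[of n] less_le_trans by blast
    define B where "B n = (L - ?S n) / a n" for n
    have "B n > 0" if "n \<ge> 1" for n
      unfolding B_def using S_less_L[of n] assms[OF that] by simp
    \<comment> \<open>Since \<open>B n * a n\<close> is the remainder \<open>L - ?S n\<close>, the
      left side is the difference of two consecutive remainders, namely \<open>a (n + 1)\<close>,
      divided by \<open>a (n + 1)\<close>.\<close>
    moreover have "B n * (a n / a (n + 1)) - B (n + 1) = 1" if "n \<ge> 1" for n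
    proof -
      have pos: "a n > 0" "a (n + 1) > 0"
        using assms that by auto
      then show ?thesis
        unfolding B_def by (simp add: field_simps)
    qed
    ultimately show ?R
      by (intro exI[of _ B] exI[of _ 1]) auto
  next
    assume ?R
    then obtain B N where B: "\<And>n. n \<ge> 1 \<Longrightarrow> B n > 0" and N: "N \<ge> 1"
      and ineq: "\<And>n. n \<ge> N \<Longrightarrow> B n * (a n / a (n + 1)) - B (n + 1) \<ge> (1::real)"
      by blast
    have bound: "?S n + B n * a n \<le> ?S N + B N * a N" if "n \<ge> N" for n
      using that
    proof (induction n rule: dec_induct)
      case (step n)
      have "a (Suc n) > 0"
        by (simp add: assms)
      \<comment> \<open>Multiplying by \<open>a (Suc n) > 0\<close> clears the denominator; the
        summand \<open>a (Suc n)\<close> is exactly the growth of the partial sum.\<close>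
      with ineq[OF step.hyps(1)] have "a (Suc n) + B (Suc n) * a (Suc n) \<le> B n * a n"
        by (simp add: field_simps)
      with step.IH show ?case
        unfolding S_Suc by linarith
    qed simp
    have "?S n \<le> ?S N + B N * a N" for n
    proof -
      \<comment> \<open>\<open>bound\<close> only covers indices from \<open>N\<close> on; smaller
        \<open>n\<close> are reached by monotonicity of the partial sums.\<close>
      define m where "m = max n N"
      have "B m * a m > 0"
        using N by (intro mult_pos_pos B assms) (auto simp: m_def)
      moreover have "?S n \<le> ?S m"
        using inc by (rule incseqD) (simp add: m_def)
      moreover have "?S m + B m * a m \<le> ?S N + B N * a N"
        by (rule bound) (simp add: m_def)
      ultimately show ?thesis
        by linarith
    qed
    with inc show "convergent ?S"
      by (metis incseq_convergent convergent_def)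
  }
qed

end
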